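(* Let $\varphi$ be a closed Hyper-maxHML formula and let $T\in\mathsf{HTrc}_{\mathcal L}$. If $\mathcal M_\emptyset(\varphi)\triangleright T\rightarrowtail^*\mathsf{no}$, then $T\notin[\![\varphi]\!]$; if $\mathcal M_\emptyset(\varphi)\triangleright T\rightarrowtail^*\mathsf{yes}$, then $T\in[\![\varphi]\!]$.
   Context: Model. Fix a finite set $\mathsf{Act}$ of actions with $|\mathsf{Act}|\ge 2$ and a finite non-empty set $\mathcal L$ of locations. Let $\mathsf{Trc}=\mathsf{Act}^\omega$. A hypertrace on $\mathcal L$ is a function $T:\mathcal L\to\mathsf{Trc}$; $\mathsf{HTrc}_{\mathcal L}$ is the set of hypertraces. For $A:\mathcal L\to\mathsf{Act}$ and $T,T'\in\mathsf{HTrc}_{\mathcal L}$ write $T\xrightarrow{A}T'$ iff $T(\ell)=A(\ell)\,T'(\ell)$ for every $\ell\in\mathcal L$; for each $T$ there is exactly one such pair $(A,T')$, written $(hd(T),tl(T))$. Logic. Let $\Pi$ (location variables $\pi$) and $V$ (recursion variables $x$) be disjoint countably infinite sets. Hyper-recHML formulas: $\varphi::=\mathsf{tt}\mid\mathsf{ff}\mid\varphi\wedge\varphi\mid\varphi\vee\varphi\mid\max x.\varphi\mid\min x.\varphi\mid x\mid\exists\pi.\varphi\mid\forall\pi.\varphi\mid\pi=\pi\mid\pi\neq\pi\mid[a_\pi]\varphi\mid\langle a_\pi\rangle\varphi$ with $a\in\mathsf{Act}$. Formulas are guarded (each recursion variable occurs within the scope of a modality inside its binding fixed point), and bound location variables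 are pairwise distinct and distinct from free ones. $\mathsf{fv_l}(\varphi)$ and $\mathsf{fv_r}(\varphi)$ denote the free location and free recursion variables; $\varphi$ is closed if both are empty. Hyper-maxHML is the set of formulas containing no $\min$. For partial maps $\rho:V\rightharpoonup 2^{\mathsf{HTrc}_{\mathcal L}}$ and $\sigma:\Pi\rightharpoonup\mathcal L$ defined on the free recursion/location variables, $[\![\varphi]\!]^\rho_\sigma\subseteq\mathsf{HTrc}_{\mathcal L}$ is: $[\![\mathsf{tt}]\!]^\rho_\sigma=\mathsf{HTrc}_{\mathcal L}$; $[\![\mathsf{ff}]\!]^\rho_\sigma=\emptyset$; $[\![x]\!]^\rho_\sigma=\rho(x)$; $\wedge,\vee$ are intersection and union; $[\![\max x.\psi]\!]^\rho_\sigma=\bigcup\{S\mid S\subseteq[\![\psi]\!]^{\rho[x\mapsto S]}_\sigma\}$; $[\![\min x.\psi]\!]^\rho_\sigma=\bigcap\{S\mid S\supseteq[\![\psi]\!]^{\rho[x\mapsto S]}_\sigma\}$; $[\![\exists\pi.\psi]\!]^\rho_\sigma=\bigcup_{\ell\in\mathcal L}[\![\psi]\!]^\rho_{\sigma[\pi\mapsto\ell]}$; $[\![\forall\pi.\psi]\!]^\rho_\sigma=\bigcap_{\ell\in\mathcal L}[\![\psi]\!]^\rho_{\sigma[\pi\mapsto\ell]}$; $[\![\pi=\pi']\!]^\rho_\sigma$ is $\mathsf{HTrc}_{\mathcal L}$ if $\sigma(\pi)=\sigma(\pi')$ and $\emptyset$ otherwise, dually for $\pi\neq\pi'$; $[\![[a_\pi]\psi]\!]^\rho_\sigma=\{T\mid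 hd(T)(\sigma(\pi))=a\Rightarrow tl(T)\in[\![\psi]\!]^\rho_\sigma\}$; $[\![\langle a_\pi\rangle\psi]\!]^\rho_\sigma=\{T\mid hd(T)(\sigma(\pi))=a\text{ and }tl(T)\in[\![\psi]\!]^\rho_\sigma\}$. For closed $\varphi$, $[\![\varphi]\!]=[\![\varphi]\!]^\emptyset_\emptyset$. Centralized monitors: $m::=\mathsf{yes}\mid\mathsf{no}\mid\mathsf{end}\mid a_\ell.m\mid m+m\mid m\oplus m\mid m\otimes m\mid\mathsf{rec}\,x.m\mid x$ ($a\in\mathsf{Act}$, $\ell\in\mathcal L$, $x\in V$); verdicts $v\in\{\mathsf{yes},\mathsf{no},\mathsf{end}\}$; $\odot$ denotes $\otimes$ or $\oplus$. Transitions $m\xrightarrow{A}m'$ (least relation): $v\xrightarrow{A}v$; $a_\ell.m\xrightarrow{A}m$ if $A(\ell)=a$; $a_\ell.m\xrightarrow{A}\mathsf{end}$ if $A(\ell)\neq a$; $\mathsf{rec}\,x.m\xrightarrow{A}m'$ if $m\{\mathsf{rec}\,x.m/x\}\xrightarrow{A}m'$; $m+n\xrightarrow{A}m'$ if $m\xrightarrow{A}m'$ and $m+n\xrightarrow{A}n'$ if $n\xrightarrow{A}n'$; $m\odot n\xrightarrow{A}m'\odot n'$ if $m\xrightarrow{A}m'$ and $n\xrightarrow{A}n'$. Verdict evaluation $m\Rrightarrow v$ is the least relation closed under these rules (each also with operands of $+,\otimes,\oplus$ swapped): $v\Rrightarrow v$; $m\odot n\Rrightarrow\mathsf{end}$ if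 $m\Rrightarrow\mathsf{end}$ and $n\Rrightarrow\mathsf{end}$; $m\oplus n\Rrightarrow\mathsf{yes}$ if $m\Rrightarrow\mathsf{yes}$; $m\otimes n\Rrightarrow\mathsf{no}$ if $m\Rrightarrow\mathsf{no}$; $m+n\Rrightarrow v$ if $m\Rrightarrow v$; $m\oplus n\Rrightarrow v$ if $m\Rrightarrow\mathsf{no}$ and $n\Rrightarrow v$; $m\otimes n\Rrightarrow v$ if $m\Rrightarrow\mathsf{yes}$ and $n\Rrightarrow v$; $\mathsf{rec}\,x.m\Rrightarrow v$ if $m\{\mathsf{rec}\,x.m/x\}\Rrightarrow v$. Instrumentation: $m\triangleright T\rightarrowtail m'\triangleright T'$ if $m\xrightarrow{A}m'$ and $T\xrightarrow{A}T'$ for some $A$; $m\triangleright T\rightarrowtail v$ if $m\Rrightarrow v$; $\rightarrowtail^*$ is the reflexive-transitive closure. Centralized synthesis: for a Hyper-maxHML formula $\varphi$ and $\sigma:\Pi\rightharpoonup\mathcal L$ defined on $\mathsf{fv_l}(\varphi)$: $\mathcal M_\sigma(\mathsf{tt})=\mathsf{yes}$, $\mathcal M_\sigma(\mathsf{ff})=\mathsf{no}$, $\mathcal M_\sigma(x)=x$, $\mathcal M_\sigma(\max x.\varphi)=\mathsf{rec}\,x.\mathcal M_\sigma(\varphi)$, $\mathcal M_\sigma(\varphi\wedge\varphi')=\mathcal M_\sigma(\varphi)\otimes\mathcal M_\sigma(\varphi')$, $\mathcal M_\sigma(\varphi\vee\varphi')=\mathcal M_\sigma(\varphi)\oplus\mathcal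 M_\sigma(\varphi')$, $\mathcal M_\sigma(\forall\pi.\varphi)=\bigotimes_{\ell\in\mathcal L}\mathcal M_{\sigma[\pi\mapsto\ell]}(\varphi)$, $\mathcal M_\sigma(\exists\pi.\varphi)=\bigoplus_{\ell\in\mathcal L}\mathcal M_{\sigma[\pi\mapsto\ell]}(\varphi)$, $\mathcal M_\sigma(\pi=\pi')=\mathsf{yes}$ if $\sigma(\pi)=\sigma(\pi')$ else $\mathsf{no}$, $\mathcal M_\sigma(\pi\neq\pi')=\mathsf{yes}$ if $\sigma(\pi)\neq\sigma(\pi')$ else $\mathsf{no}$, $\mathcal M_\sigma([a_\pi]\varphi)=a_{\sigma(\pi)}.\mathcal M_\sigma(\varphi)+\sum_{b\neq a}b_{\sigma(\pi)}.\mathsf{yes}$, $\mathcal M_\sigma(\langle a_\pi\rangle\varphi)=a_{\sigma(\pi)}.\mathcal M_\sigma(\varphi)+\sum_{b\neq a}b_{\sigma(\pi)}.\mathsf{no}$. *)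

theory Defs
  imports "HOL-Library.Stream" "HOL-Library.Cardinality"
begin

section \<open>Hypertraces\<close>

text \<open>The finite set of actions is a type \<open>'act\<close> and the finite non-empty set of locations a
  type \<open>'loc\<close>, both of class \<open>finite\<close>.\<close>

type_synonym ('act, 'loc) htrc = "'loc \<Rightarrow> 'act stream"

definition htrans :: "('act, 'loc) htrc \<Rightarrow> ('loc \<Rightarrow> 'act) \<Rightarrow> ('act, 'loc) htrc \<Rightarrow> bool" where
  "htrans T A T' \<longleftrightarrow> (\<forall>l. T l = A l ## T' l)"

definition hhd :: "('act, 'loc) htrc \<Rightarrow> 'loc \<Rightarrow> 'act" where
  "hhd T = (\<lambda>l. shd (T l))"

definition htl :: "('act, 'loc) htrc \<Rightarrow> ('act, 'loc) htrc" where
  "htl T = (\<lambda>l. stl (T l))"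

lemma htrans_iff: "htrans T A T' \<longleftrightarrow> A = hhd T \<and> T' = htl T"
proof
  assume "htrans T A T'"
  then show "A = hhd T \<and> T' = htl T"
    by (simp add: htrans_def hhd_def htl_def)
next
  assume "A = hhd T \<and> T' = htl T"
  then show "htrans T A T'"
    by (simp add: htrans_def hhd_def htl_def)
qed

section \<open>Hyper-recHML\<close>

datatype lvar = LVar nat
datatype rvar = RVar nat

datatype 'act formula =
    TT
  | FF
  | And "'act formula" "'act formula"
  | Or "'act formula" "'act formula"
  | MaxFix rvar "'act formula"
  | MinFix rvar "'act formula"
  | FVar rvar
  | Exists lvar "'act formula"
  | Forall lvar "'act formula"
  | LEq lvar lvar
  | LNeq lvar lvar
  | Box 'act lvar "'act formula"
  | Diamond 'act lvar "'act formula"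

primrec fv_l :: "'act formula \<Rightarrow> lvar set" where
  "fv_l TT = {}"
| "fv_l FF = {}"
| "fv_l (And p q) = fv_l p \<union> fv_l q"
| "fv_l (Or p q) = fv_l p \<union> fv_l q"
| "fv_l (MaxFix x p) = fv_l p"
| "fv_l (MinFix x p) = fv_l p"
| "fv_l (FVar x) = {}"
| "fv_l (Exists i p) = fv_l p - {i}"
| "fv_l (Forall i p) = fv_l p - {i}"
| "fv_l (LEq i j) = {i, j}"
| "fv_l (LNeq i j) = {i, j}"
| "fv_l (Box a i p) = insert i (fv_l p)"
| "fv_l (Diamond a i p) = insert i (fv_l p)"

primrec fv_r :: "'act formula \<Rightarrow> rvar set" where
  "fv_r TT = {}"
| "fv_r FF = {}"
| "fv_r (And p q) = fv_r p \<union> fv_r q"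
| "fv_r (Or p q) = fv_r p \<union> fv_r q"
| "fv_r (MaxFix x p) = fv_r p - {x}"
| "fv_r (MinFix x p) = fv_r p - {x}"
| "fv_r (FVar x) = {x}"
| "fv_r (Exists i p) = fv_r p"
| "fv_r (Forall i p) = fv_r p"
| "fv_r (LEq i j) = {}"
| "fv_r (LNeq i j) = {}"
| "fv_r (Box a i p) = fv_r p"
| "fv_r (Diamond a i p) = fv_r p"

definition closed_formula :: "'act formula \<Rightarrow> bool" where
  "closed_formula p \<longleftrightarrow> fv_l p = {} \<and> fv_r p = {}"

text \<open>Location variables bound by a quantifier, one list entry per quantifier occurrence.\<close>

primrec bv_l :: "'act formula \<Rightarrow> lvar list" where
  "bv_l TT = []"
| "bv_l FF = []"
| "bv_l (And p q) = bv_l p @ bv_l q"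
| "bv_l (Or p q) = bv_l p @ bv_l q"
| "bv_l (MaxFix x p) = bv_l p"
| "bv_l (MinFix x p) = bv_l p"
| "bv_l (FVar x) = []"
| "bv_l (Exists i p) = i # bv_l p"
| "bv_l (Forall i p) = i # bv_l p"
| "bv_l (LEq i j) = []"
| "bv_l (LNeq i j) = []"
| "bv_l (Box a i p) = bv_l p"
| "bv_l (Diamond a i p) = bv_l p"

text \<open>Recursion variables with a free occurrence that is not within the scope of a modality.\<close>

primrec unguarded_vars :: "'act formula \<Rightarrow> rvar set" where
  "unguarded_vars TT = {}"
| "unguarded_vars FF = {}"
| "unguarded_vars (And p q) = unguarded_vars p \<union> unguarded_vars q"
| "unguarded_vars (Or p q) = unguarded_vars p \<union> unguarded_vars q"
| "unguarded_vars (MaxFix x p) = unguarded_vars p - {x}"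
| "unguarded_vars (MinFix x p) = unguarded_vars p - {x}"
| "unguarded_vars (FVar x) = {x}"
| "unguarded_vars (Exists i p) = unguarded_vars p"
| "unguarded_vars (Forall i p) = unguarded_vars p"
| "unguarded_vars (LEq i j) = {}"
| "unguarded_vars (LNeq i j) = {}"
| "unguarded_vars (Box a i p) = {}"
| "unguarded_vars (Diamond a i p) = {}"

primrec guarded :: "'act formula \<Rightarrow> bool" where
  "guarded TT = True"
| "guarded FF = True"
| "guarded (And p q) = (guarded p \<and> guarded q)"
| "guarded (Or p q) = (guarded p \<and> guarded q)"
| "guarded (MaxFix x p) = (x \<notin> unguarded_vars p \<and> guarded p)"
| "guarded (MinFix x p) = (x \<notin> unguarded_vars p \<and> guarded p)"
| "guarded (FVar x) = True"
| "guarded (Exists i p) = guarded p"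
| "guarded (Forall i p) = guarded p"
| "guarded (LEq i j) = True"
| "guarded (LNeq i j) = True"
| "guarded (Box a i p) = guarded p"
| "guarded (Diamond a i p) = guarded p"

definition hyper_recHML :: "'act formula \<Rightarrow> bool" where
  "hyper_recHML p \<longleftrightarrow> guarded p \<and> distinct (bv_l p) \<and> set (bv_l p) \<inter> fv_l p = {}"

primrec min_free :: "'act formula \<Rightarrow> bool" where
  "min_free TT = True"
| "min_free FF = True"
| "min_free (And p q) = (min_free p \<and> min_free q)"
| "min_free (Or p q) = (min_free p \<and> min_free q)"
| "min_free (MaxFix x p) = min_free p"
| "min_free (MinFix x p) = False"
| "min_free (FVar x) = True"
| "min_free (Exists i p) = min_free p"
| "min_free (Forall i p) = min_free p"
| "min_free (LEq i j) = True"
| "min_free (LNeq i j) = True"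
| "min_free (Box a i p) = min_free p"
| "min_free (Diamond a i p) = min_free p"

definition hyper_maxHML :: "'act formula \<Rightarrow> bool" where
  "hyper_maxHML p \<longleftrightarrow> hyper_recHML p \<and> min_free p"

text \<open>The environments are partial maps; the semantics is meaningful when they are defined on the
  free variables of the formula (otherwise \<open>the None\<close> is an unspecified value).\<close>

primrec sem :: "'act formula \<Rightarrow> (rvar \<rightharpoonup> ('act, 'loc) htrc set) \<Rightarrow> (lvar \<rightharpoonup> 'loc)
    \<Rightarrow> ('act, 'loc) htrc set" where
  "sem TT \<rho> \<sigma> = UNIV"
| "sem FF \<rho> \<sigma> = {}"
| "sem (And p q) \<rho> \<sigma> = sem p \<rho> \<sigma> \<inter> sem q \<rho> \<sigma>"
| "sem (Or p q) \<rho> \<sigma> = sem p \<rho> \<sigma> \<union> sem q \<rho> \<sigma>"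
| "sem (MaxFix x p) \<rho> \<sigma> = \<Union> {S. S \<subseteq> sem p (\<rho>(x \<mapsto> S)) \<sigma>}"
| "sem (MinFix x p) \<rho> \<sigma> = \<Inter> {S. S \<supseteq> sem p (\<rho>(x \<mapsto> S)) \<sigma>}"
| "sem (FVar x) \<rho> \<sigma> = the (\<rho> x)"
| "sem (Exists i p) \<rho> \<sigma> = (\<Union>l. sem p \<rho> (\<sigma>(i \<mapsto> l)))"
| "sem (Forall i p) \<rho> \<sigma> = (\<Inter>l. sem p \<rho> (\<sigma>(i \<mapsto> l)))"
| "sem (LEq i j) \<rho> \<sigma> = (if the (\<sigma> i) = the (\<sigma> j) then UNIV else {})"
| "sem (LNeq i j) \<rho> \<sigma> = (if the (\<sigma> i) \<noteq> the (\<sigma> j) then UNIV else {})"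
| "sem (Box a i p) \<rho> \<sigma> = {T. hhd T (the (\<sigma> i)) = a \<longrightarrow> htl T \<in> sem p \<rho> \<sigma>}"
| "sem (Diamond a i p) \<rho> \<sigma> = {T. hhd T (the (\<sigma> i)) = a \<and> htl T \<in> sem p \<rho> \<sigma>}"

section \<open>Centralized monitors\<close>

datatype verdict = Yes | No | End

datatype ('act, 'loc) monitor =
    Verdict verdict
  | Prefix 'act 'loc "('act, 'loc) monitor"
  | Choice "('act, 'loc) monitor" "('act, 'loc) monitor"
  | ParOr "('act, 'loc) monitor" "('act, 'loc) monitor"
  | ParAnd "('act, 'loc) monitor" "('act, 'loc) monitor"
  | Rec rvar "('act, 'loc) monitor"
  | MVar rvar

text \<open>\<open>subst n x m\<close> is \<open>m{n/x}\<close>. There is no renaming of bound variables: unfolding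
  \<open>Rec x m\<close> substitutes \<open>Rec x m\<close> itself, which is closed whenever the running monitor is
  closed, so no capture can occur on monitors reachable from a closed one.\<close>

primrec subst :: "('act, 'loc) monitor \<Rightarrow> rvar \<Rightarrow> ('act, 'loc) monitor \<Rightarrow> ('act, 'loc) monitor" where
  "subst n x (Verdict v) = Verdict v"
| "subst n x (Prefix a l m) = Prefix a l (subst n x m)"
| "subst n x (Choice m m') = Choice (subst n x m) (subst n x m')"
| "subst n x (ParOr m m') = ParOr (subst n x m) (subst n x m')"
| "subst n x (ParAnd m m') = ParAnd (subst n x m) (subst n x m')"
| "subst n x (Rec y m) = (if y = x then Rec y m else Rec y (subst n x m))"
| "subst n x (MVar y) = (if y = x then n else MVar y)"

inductive mtrans :: "('act, 'loc) monitor \<Rightarrow> ('loc \<Rightarrow> 'act) \<Rightarrow> ('act, 'loc) monitor \<Rightarrow> bool" where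
  "mtrans (Verdict v) A (Verdict v)"
| "A l = a \<Longrightarrow> mtrans (Prefix a l m) A m"
| "A l \<noteq> a \<Longrightarrow> mtrans (Prefix a l m) A (Verdict End)"
| "mtrans (subst (Rec x m) x m) A m' \<Longrightarrow> mtrans (Rec x m) A m'"
| "mtrans m A m' \<Longrightarrow> mtrans (Choice m n) A m'"
| "mtrans n A n' \<Longrightarrow> mtrans (Choice m n) A n'"
| "mtrans m A m' \<Longrightarrow> mtrans n A n' \<Longrightarrow> mtrans (ParOr m n) A (ParOr m' n')"
| "mtrans m A m' \<Longrightarrow> mtrans n A n' \<Longrightarrow> mtrans (ParAnd m n) A (ParAnd m' n')"

inductive veval :: "('act, 'loc) monitor \<Rightarrow> verdict \<Rightarrow> bool" where
  "veval (Verdict v) v"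
| "veval m End \<Longrightarrow> veval n End \<Longrightarrow> veval (ParOr m n) End"
| "veval m End \<Longrightarrow> veval n End \<Longrightarrow> veval (ParAnd m n) End"
| "veval m Yes \<Longrightarrow> veval (ParOr m n) Yes"
| "veval n Yes \<Longrightarrow> veval (ParOr m n) Yes"
| "veval m No \<Longrightarrow> veval (ParAnd m n) No"
| "veval n No \<Longrightarrow> veval (ParAnd m n) No"
| "veval m v \<Longrightarrow> veval (Choice m n) v"
| "veval n v \<Longrightarrow> veval (Choice m n) v"
| "veval m No \<Longrightarrow> veval n v \<Longrightarrow> veval (ParOr m n) v"
| "veval n No \<Longrightarrow> veval m v \<Longrightarrow> veval (ParOr m n) v"
| "veval m Yes \<Longrightarrow> veval n v \<Longrightarrow> veval (ParAnd m n) v"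
| "veval n Yes \<Longrightarrow> veval m v \<Longrightarrow> veval (ParAnd m n) v"
| "veval (subst (Rec x m) x m) v \<Longrightarrow> veval (Rec x m) v"

text \<open>An instrumented system is either a monitor running on a hypertrace or a final verdict.\<close>

datatype ('act, 'loc) config =
    Instr "('act, 'loc) monitor" "('act, 'loc) htrc"
  | Reached verdict

inductive istep :: "('act, 'loc) config \<Rightarrow> ('act, 'loc) config \<Rightarrow> bool" where
  "mtrans m A m' \<Longrightarrow> htrans T A T' \<Longrightarrow> istep (Instr m T) (Instr m' T')"
| "veval m v \<Longrightarrow> istep (Instr m T) (Reached v)"

section \<open>Centralized synthesis\<close>

text \<open>Monitors only have binary operators, so an n-ary combination is a right-nested binary one over
  a (non-empty) list: \<open>big f [m\<^sub>1, m\<^sub>2, m\<^sub>3] = f m\<^sub>1 (f m\<^sub>2 m\<^sub>3)\<close>.\<close>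

definition big :: "('m \<Rightarrow> 'm \<Rightarrow> 'm) \<Rightarrow> 'm list \<Rightarrow> 'm" where
  "big f ms = foldr f (butlast ms) (last ms)"

text \<open>The lists \<open>acts\<close> and \<open>locs\<close> enumerate all actions and all locations; they determine the order of
  the operands in the n-ary combinations. The synthesis is left unspecified on \<open>MinFix\<close>.\<close>

primrec (nonexhaustive) synth :: "'act list \<Rightarrow> 'loc list \<Rightarrow> 'act formula \<Rightarrow> (lvar \<rightharpoonup> 'loc)
    \<Rightarrow> ('act, 'loc) monitor" where
  "synth acts locs TT \<sigma> = Verdict Yes"
| "synth acts locs FF \<sigma> = Verdict No"
| "synth acts locs (And p q) \<sigma> = ParAnd (synth acts locs p \<sigma>) (synth acts locs q \<sigma>)"
| "synth acts locs (Or p q) \<sigma> = ParOr (synth acts locs p \<sigma>) (synth acts locs q \<sigma>)"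
| "synth acts locs (MaxFix x p) \<sigma> = Rec x (synth acts locs p \<sigma>)"
| "synth acts locs (FVar x) \<sigma> = MVar x"
| "synth acts locs (Exists i p) \<sigma> = big ParOr (map (\<lambda>l. synth acts locs p (\<sigma>(i \<mapsto> l))) locs)"
| "synth acts locs (Forall i p) \<sigma> = big ParAnd (map (\<lambda>l. synth acts locs p (\<sigma>(i \<mapsto> l))) locs)"
| "synth acts locs (LEq i j) \<sigma> = Verdict (if the (\<sigma> i) = the (\<sigma> j) then Yes else No)"
| "synth acts locs (LNeq i j) \<sigma> = Verdict (if the (\<sigma> i) \<noteq> the (\<sigma> j) then Yes else No)"
| "synth acts locs (Box a i p) \<sigma> =
     Choice (Prefix a (the (\<sigma> i)) (synth acts locs p \<sigma>))
       (big Choice (map (\<lambda>b. Prefix b (the (\<sigma> i)) (Verdict Yes)) (filter (\<lambda>b. b \<noteq> a) acts)))"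
| "synth acts locs (Diamond a i p) \<sigma> =
     Choice (Prefix a (the (\<sigma> i)) (synth acts locs p \<sigma>))
       (big Choice (map (\<lambda>b. Prefix b (the (\<sigma> i)) (Verdict No)) (filter (\<lambda>b. b \<noteq> a) acts)))"

end

(* The runs of a monitor are replaced by a compositional acceptance predicate with a bound on the
   number of unfoldings of recursion. The synthesised monitor of a formula, closed under monitors that
   are sound up to n unfoldings, is then itself sound up to n unfoldings, by induction on the formula;
   at a greatest fixed point an inner induction on n combines with sem (max x. p) being a fixed point
   of the body. *)
theory Submission imports Defs begin

section \<open>Bounded acceptance\<close>

text \<open>\<open>acc n v m T\<close> is only meaningful for \<open>v \<noteq> End\<close>: the rules that produce \<open>End\<close> are ignored.\<close>

function acc :: "nat \<Rightarrow> verdict \<Rightarrow> ('act, 'loc) monitor \<Rightarrow> ('act, 'loc) htrc \<Rightarrow> bool" where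
  "acc n v (Verdict u) T \<longleftrightarrow> u = v"
| "acc n v (Prefix a l m) T \<longleftrightarrow> hhd T l = a \<and> acc n v m (htl T)"
| "acc n v (Choice m m') T \<longleftrightarrow> acc n v m T \<or> acc n v m' T"
| "acc n v (ParOr m m') T \<longleftrightarrow>
     (if v = Yes then acc n v m T \<or> acc n v m' T else acc n v m T \<and> acc n v m' T)"
| "acc n v (ParAnd m m') T \<longleftrightarrow>
     (if v = No then acc n v m T \<or> acc n v m' T else acc n v m T \<and> acc n v m' T)"
| "acc 0 v (Rec x m) T \<longleftrightarrow> False"
| "acc (Suc n) v (Rec x m) T \<longleftrightarrow> acc n v (subst (Rec x m) x m) T"
| "acc n v (MVar x) T \<longleftrightarrow> False"
  by pat_completeness auto
termination
  \<comment> \<open>The unfolding \<open>subst (Rec x m) x m\<close> may be larger than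
    \<open>Rec x m\<close>, so the bound comes first in the order.\<close>
  by (relation "inv_image (less_than <*lex*> less_than) (\<lambda>(n, v, m, T). (n, size m))") auto

lemma acc_mono: "acc n v m T \<Longrightarrow> n \<le> n' \<Longrightarrow> acc n' v m T"
proof (induction n v m T arbitrary: n' rule: acc.induct)
  case (7 n v x m T)
  then show ?case by (cases n') auto
qed (auto split: if_splits)

text \<open>By monotonicity the larger of the two bounds serves both. This is what conjunctive
  acceptance at a parallel operator requires.\<close>

lemma acc_common_bound:
  assumes "\<exists>n. acc n v m T" "\<exists>n. acc n v' m' T'"
  shows "\<exists>n. acc n v m T \<and> acc n v' m' T'"
  using assms by (meson acc_mono nat_le_linear)

lemma acc_veval: "veval m v \<Longrightarrow> v \<noteq> End \<Longrightarrow> \<exists>n. acc n v m T"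
proof (induction rule: veval.induct)
  case (10 m n v)
  \<comment> \<open>If \<open>v\<close> is \<open>Yes\<close>, the operand \<open>n\<close> suffices
    alone; if \<open>v\<close> is \<open>No\<close>, both operands must accept under one
    bound.\<close>
  then show ?case using acc_common_bound[of No m T v n T] by (cases v) auto
next
  case (11 n m v)
  then show ?case using acc_common_bound[of No n T v m T] by (cases v) auto
next
  case (12 m n v)
  then show ?case using acc_common_bound[of Yes m T v n T] by (cases v) auto
next
  case (13 n m v)
  then show ?case using acc_common_bound[of Yes n T v m T] by (cases v) auto
next
  case (14 x m v)
  then show ?case by (metis acc.simps(7))
qed auto

text \<open>Acceptance is pulled back along a transition, with one more unfolding per use of the
  \<open>Rec\<close> rule. A mismatched prefix moves to \<open>Verdict End\<close>, which accepts no
  other verdict; hence \<open>v \<noteq> End\<close>.\<close>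

lemma acc_mtrans:
  "mtrans m A m' \<Longrightarrow> A = hhd T \<Longrightarrow> acc n v m' (htl T) \<Longrightarrow> v \<noteq> End \<Longrightarrow> \<exists>n. acc n v m T"
proof (induction arbitrary: n rule: mtrans.induct)
  case (4 x m A m')
  then show ?case by (metis acc.simps(7))
next
  case (7 m A m' k k')
  then show ?case using acc_common_bound[of v m T v k T]
    by (cases v) (auto simp: ex_disj_distrib)
next
  case (8 m A m' k k')
  then show ?case using acc_common_bound[of v m T v k T]
    by (cases v) (auto simp: ex_disj_distrib)
qed auto

lemma acc_istep:
  assumes "istep\<^sup>*\<^sup>* (Instr m T) (Reached v)" "v \<noteq> End"
  shows "\<exists>n. acc n v m T"
proof -
  have "\<forall>m T. c = Instr m T \<longrightarrow> (\<exists>n. acc n v m T)"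
    if "istep\<^sup>*\<^sup>* c d" "d = Reached v" for c d :: "('act, 'loc) config"
    using that
  proof (induction rule: converse_rtranclp_induct)
    case base
    then show ?case by simp
  next
    case (step c c')
    from step.hyps(1) show ?case
    proof cases
      case (1 m A m' T T')
      with step show ?thesis using acc_mtrans[of m A m' T] assms(2) by (auto simp: htrans_iff)
    next
      case (2 m u T)
      \<comment> \<open>No step leaves \<open>Reached u\<close>, so the run ends here.\<close>
      from step.hyps(2) 2 step.prems have "u = v"
        by (auto elim: converse_rtranclpE istep.cases)
      with 2 show ?thesis using acc_veval assms(2) by auto
    qed
  qed
  with assms show ?thesis by blast
qed

section \<open>Closing substitutions\<close>

primrec mfv :: "('act, 'loc) monitor \<Rightarrow> rvar set" where
  "mfv (Verdict v) = {}"
| "mfv (Prefix a l m) = mfv m"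
| "mfv (Choice m m') = mfv m \<union> mfv m'"
| "mfv (ParOr m m') = mfv m \<union> mfv m'"
| "mfv (ParAnd m m') = mfv m \<union> mfv m'"
| "mfv (Rec x m) = mfv m - {x}"
| "mfv (MVar x) = {x}"

primrec psubst ::
  "(rvar \<rightharpoonup> ('act, 'loc) monitor) \<Rightarrow> ('act, 'loc) monitor \<Rightarrow> ('act, 'loc) monitor" where
  "psubst \<theta> (Verdict v) = Verdict v"
| "psubst \<theta> (Prefix a l m) = Prefix a l (psubst \<theta> m)"
| "psubst \<theta> (Choice m m') = Choice (psubst \<theta> m) (psubst \<theta> m')"
| "psubst \<theta> (ParOr m m') = ParOr (psubst \<theta> m) (psubst \<theta> m')"
| "psubst \<theta> (ParAnd m m') = ParAnd (psubst \<theta> m) (psubst \<theta> m')"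
| "psubst \<theta> (Rec x m) = Rec x (psubst (\<theta>(x := None)) m)"
| "psubst \<theta> (MVar x) = (case \<theta> x of None \<Rightarrow> MVar x | Some m \<Rightarrow> m)"

text \<open>\<open>psubst\<close> goes under \<open>Rec\<close> without renaming; closed images
  exclude capture.\<close>

definition closing :: "(rvar \<rightharpoonup> ('act, 'loc) monitor) \<Rightarrow> bool" where
  "closing \<theta> \<longleftrightarrow> (\<forall>m\<in>ran \<theta>. mfv m = {})"

lemma closing_remove: "closing \<theta> \<Longrightarrow> closing (\<theta>(x := None))"
  by (auto simp: closing_def ran_def)

lemma closing_update: "closing \<theta> \<Longrightarrow> mfv m = {} \<Longrightarrow> closing (\<theta>(x \<mapsto> m))"
  by (auto simp: closing_def ran_def)

lemma psubst_empty: "psubst Map.empty m = m"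
  by (induction m) (auto simp: fun_upd_idem)

lemma subst_fresh: "x \<notin> mfv m \<Longrightarrow> subst k x m = m"
  by (induction m) auto

lemma mfv_psubst: "closing \<theta> \<Longrightarrow> mfv (psubst \<theta> m) = mfv m - dom \<theta>"
proof (induction m arbitrary: \<theta>)
  case (Rec x m)
  from Rec.IH[OF closing_remove[OF Rec.prems, of x]] show ?case by (auto simp del: fun_upd_apply)
next
  case (MVar x)
  then show ?case by (auto simp: closing_def ran_def split: option.split)
qed auto

text \<open>A later \<open>subst\<close> for \<open>x\<close> leaves the images of
  \<open>\<theta>\<close> alone because they are closed. Thus unfolding a recursion amounts to
  extending the closing substitution at \<open>x\<close>.\<close>

lemma subst_psubst:
  "closing \<theta> \<Longrightarrow> subst k x (psubst (\<theta>(x := None)) m) = psubst (\<theta>(x \<mapsto> k)) m"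
proof (induction m arbitrary: \<theta>)
  case (Rec y m)
  then show ?case
    using Rec.IH[of "\<theta>(y := None)"]
    by (cases "y = x") (simp_all add: closing_remove fun_upd_twist del: fun_upd_apply)
next
  case (MVar y)
  then show ?case by (auto simp: closing_def ran_def subst_fresh split: option.split)
qed auto

section \<open>Finite combinations of monitors\<close>

lemma big_single [simp]: "big f [m] = m"
  by (simp add: big_def)

lemma big_Cons [simp]: "ms \<noteq> [] \<Longrightarrow> big f (m # ms) = f m (big f ms)"
  by (simp add: big_def)

lemma mfv_big:
  assumes "ms \<noteq> []" "f \<in> {Choice, ParOr, ParAnd}"
  shows "mfv (big f ms) = (\<Union>m\<in>set ms. mfv m)"
  using assms by (induction ms rule: list_nonempty_induct) auto

lemma psubst_big:
  assumes "ms \<noteq> []" "f \<in> {Choice, ParOr, ParAnd}"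
  shows "psubst \<theta> (big f ms) = big f (map (psubst \<theta>) ms)"
  using assms by (induction ms rule: list_nonempty_induct) auto

lemma acc_big_Choice: "ms \<noteq> [] \<Longrightarrow> acc n v (big Choice ms) T \<longleftrightarrow> (\<exists>m\<in>set ms. acc n v m T)"
  by (induction ms rule: list_nonempty_induct) auto

lemma acc_big_ParOr:
  "ms \<noteq> [] \<Longrightarrow> acc n v (big ParOr ms) T \<longleftrightarrow>
     (if v = Yes then \<exists>m\<in>set ms. acc n v m T else \<forall>m\<in>set ms. acc n v m T)"
  by (induction ms rule: list_nonempty_induct) auto

lemma acc_big_ParAnd:
  "ms \<noteq> [] \<Longrightarrow> acc n v (big ParAnd ms) T \<longleftrightarrow>
     (if v = No then \<exists>m\<in>set ms. acc n v m T else \<forall>m\<in>set ms. acc n v m T)"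
  by (induction ms rule: list_nonempty_induct) auto

text \<open>\<open>big\<close> is meaningful only on non-empty lists; this covers the sums over the
  other actions in the modal clauses.\<close>

lemma exists_other_action:
  assumes "CARD('act::finite) \<ge> 2" "set (acts :: 'act list) = UNIV"
  shows "filter (\<lambda>b. b \<noteq> a) acts \<noteq> []"
proof
  assume "filter (\<lambda>b. b \<noteq> a) acts = []"
  then have "(UNIV :: 'act set) \<subseteq> {a}"
    using assms(2) by (auto simp: filter_empty_conv)
  then have "CARD('act) \<le> card {a}"
    by (intro card_mono) auto
  with assms(1) show False by simp
qed

lemma mfv_synth:
  fixes acts :: "'act::finite list" and locs :: "'loc::finite list"
  assumes "CARD('act) \<ge> 2" "set acts = UNIV" "set locs = UNIV" "min_free p"
  shows "mfv (synth acts locs p \<sigma>) = fv_r p"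
proof -
  have "locs \<noteq> []" using assms(3) by auto
  with assms(4) exists_other_action[OF assms(1,2)] assms(3) show ?thesis
    by (induction p arbitrary: \<sigma>) (auto simp: mfv_big)
qed

section \<open>Greatest fixed points\<close>

text \<open>Environments are compared through \<open>the\<close>, exactly as \<open>FVar\<close>
  reads them, so no condition on their domains arises.\<close>

lemma sem_mono:
  assumes "\<forall>x. the (\<rho> x) \<subseteq> the (\<rho>' x)"
  shows "sem p \<rho> \<sigma> \<subseteq> sem p \<rho>' \<sigma>"
  using assms
proof (induction p arbitrary: \<rho> \<rho>' \<sigma>)
  case (MaxFix x p)
  have "sem p (\<rho>(x \<mapsto> S)) \<sigma> \<subseteq> sem p (\<rho>'(x \<mapsto> S)) \<sigma>" for S
    using MaxFix.prems by (intro MaxFix.IH) auto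
  then show ?case unfolding sem.simps by blast
next
  case (MinFix x p)
  have "sem p (\<rho>(x \<mapsto> S)) \<sigma> \<subseteq> sem p (\<rho>'(x \<mapsto> S)) \<sigma>" for S
    using MinFix.prems by (intro MinFix.IH) auto
  then show ?case unfolding sem.simps by blast
next
  case (And p q)
  from And.IH[OF And.prems] show ?case unfolding sem.simps by blast
next
  case (Or p q)
  from Or.IH[OF Or.prems] show ?case unfolding sem.simps by blast
next
  case (Exists i p)
  from Exists.IH[OF Exists.prems] show ?case unfolding sem.simps by blast
next
  case (Forall i p)
  from Forall.IH[OF Forall.prems] show ?case unfolding sem.simps by blast
next
  case (Box a i p)
  from Box.IH[OF Box.prems] show ?case unfolding sem.simps by blast
next
  case (Diamond a i p)
  from Diamond.IH[OF Diamond.prems] show ?case unfolding sem.simps by blast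
qed auto

lemma sem_MaxFix_unfold: "sem (MaxFix x p) \<rho> \<sigma> = sem p (\<rho>(x \<mapsto> sem (MaxFix x p) \<rho> \<sigma>)) \<sigma>"
proof -
  have "mono (\<lambda>S. sem p (\<rho>(x \<mapsto> S)) \<sigma>)"
    by (intro monoI sem_mono) auto
  from gfp_unfold[OF this] show ?thesis
    by (simp add: gfp_def)
qed

section \<open>Soundness of the synthesis\<close>

definition sound :: "nat \<Rightarrow> ('act, 'loc) monitor \<Rightarrow> ('act, 'loc) htrc set \<Rightarrow> bool" where
  "sound n m S \<longleftrightarrow> (\<forall>T. (acc n Yes m T \<longrightarrow> T \<in> S) \<and> (acc n No m T \<longrightarrow> T \<notin> S))"

lemma sound_antimono: "sound n' m S \<Longrightarrow> n \<le> n' \<Longrightarrow> sound n m S"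
  unfolding sound_def by (meson acc_mono)

lemma sound_synth:
  fixes acts :: "'act::finite list" and locs :: "'loc::finite list"
  assumes acts: "CARD('act) \<ge> 2" "set acts = UNIV" and locs: "set locs = UNIV"
    and "min_free p" "closing \<theta>" "fv_r p \<subseteq> dom \<theta>"
    and "\<And>x. x \<in> fv_r p \<Longrightarrow> sound n (the (\<theta> x)) (the (\<rho> x))"
  shows "sound n (psubst \<theta> (synth acts locs p \<sigma>)) (sem p \<rho> \<sigma>)"
  using assms(4-)
proof (induction p arbitrary: n \<theta> \<rho> \<sigma>)
  case (And p q)
  from And.IH(1)[of \<theta> n \<rho> \<sigma>] And.IH(2)[of \<theta> n \<rho> \<sigma>] And.prems show ?case
    by (auto simp: sound_def)
next
  case (Or p q)
  from Or.IH(1)[of \<theta> n \<rho> \<sigma>] Or.IH(2)[of \<theta> n \<rho> \<sigma>] Or.prems show ?case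
    by (auto simp: sound_def)
next
  case (MaxFix x p)
  let ?m = "psubst \<theta> (synth acts locs (MaxFix x p) \<sigma>)"
  let ?S = "sem (MaxFix x p) \<rho> \<sigma>"
  have "mfv ?m = {}"
    using MaxFix.prems mfv_synth[OF acts locs, of "MaxFix x p"] by (simp only: mfv_psubst) auto
  \<comment> \<open>The instantiated recursion is closed, so it may itself become the image of
    \<open>x\<close>.\<close>
  then have closing: "closing (\<theta>(x \<mapsto> ?m))"
    using MaxFix.prems(2) by (rule closing_update[rotated])
  have unfold: "subst ?m x (psubst (\<theta>(x := None)) (synth acts locs p \<sigma>))
      = psubst (\<theta>(x \<mapsto> ?m)) (synth acts locs p \<sigma>)"
    using MaxFix.prems(2) by (rule subst_psubst)
  \<comment> \<open>The inner induction is on the bound. At 0 no \<open>Rec\<close> accepts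
    anything, so soundness is vacuous.\<close>
  from MaxFix.prems(4) show ?case
  proof (induction n)
    case 0
    then show ?case by (simp add: sound_def)
  next
    case (Suc n)
    have env: "sound n (the (\<theta> y)) (the (\<rho> y))" if "y \<in> fv_r (MaxFix x p)" for y
      using Suc.prems[OF that] by (rule sound_antimono) simp
    \<comment> \<open>Outer hypothesis for the body at the smaller bound: \<open>x\<close> is paired
      with the recursion \<open>?m\<close> and the fixed point \<open>?S\<close>, which are sound at
      \<open>n\<close> by the inner hypothesis.\<close>
    have "sound n (psubst (\<theta>(x \<mapsto> ?m)) (synth acts locs p \<sigma>)) (sem p (\<rho>(x \<mapsto> ?S)) \<sigma>)"
    proof (rule MaxFix.IH[OF _ closing])
      show "sound n (the ((\<theta>(x \<mapsto> ?m)) y)) (the ((\<rho>(x \<mapsto> ?S)) y))" if "y \<in> fv_r p" for y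
        using that env Suc.IH[OF env] by (cases "y = x") auto
    qed (use MaxFix.prems in auto)
    \<comment> \<open>Acceptance of \<open>?m\<close> at \<open>Suc n\<close> is acceptance of its
      unfolding at \<open>n\<close>, and \<open>?S\<close> equals the semantics of the body at
      \<open>?S\<close>.\<close>
    then show ?case
      using unfold unfolding sem_MaxFix_unfold[symmetric] sound_def by (simp del: sem.simps)
  qed
next
  case (FVar x)
  then show ?case by (auto simp: sound_def split: option.split)
next
  case (Exists i p)
  have "locs \<noteq> []" using locs by auto
  moreover have "sound n (psubst \<theta> (synth acts locs p (\<sigma>(i \<mapsto> l)))) (sem p \<rho> (\<sigma>(i \<mapsto> l)))" for l
    using Exists.prems by (intro Exists.IH) auto
  ultimately show ?case
    using locs by (auto simp: sound_def psubst_big acc_big_ParOr)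
next
  case (Forall i p)
  have "locs \<noteq> []" using locs by auto
  moreover have "sound n (psubst \<theta> (synth acts locs p (\<sigma>(i \<mapsto> l)))) (sem p \<rho> (\<sigma>(i \<mapsto> l)))" for l
    using Forall.prems by (intro Forall.IH) auto
  ultimately show ?case
    using locs by (auto simp: sound_def psubst_big acc_big_ParAnd)
next
  case (Box a i p)
  have "sound n (psubst \<theta> (synth acts locs p \<sigma>)) (sem p \<rho> \<sigma>)"
    using Box.prems by (intro Box.IH) auto
  \<comment> \<open>The prefixes for the other actions accept \<open>Yes\<close> exactly when the
    head at the location differs from \<open>a\<close>, and never accept \<open>No\<close>.\<close>
  then show ?case
    using exists_other_action[OF acts, of a]
    by (auto simp: sound_def psubst_big acc_big_Choice)
next
  case (Diamond a i p)
  have "sound n (psubst \<theta> (synth acts locs p \<sigma>)) (sem p \<rho> \<sigma>)"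
    using Diamond.prems by (intro Diamond.IH) auto
  then show ?case
    using exists_other_action[OF acts, of a]
    by (auto simp: sound_def psubst_big acc_big_Choice)
qed (auto simp: sound_def)

theorem theorem3p5:
  fixes \<phi> :: "'act::finite formula"
    and T :: "('act, 'loc::finite) htrc"
    and acts :: "'act list" and locs :: "'loc list"
  assumes "CARD('act) \<ge> 2"
    and "set acts = UNIV" and "distinct acts"
    and "set locs = UNIV" and "distinct locs"
    and "hyper_maxHML \<phi>" and "closed_formula \<phi>"
  shows "(istep\<^sup>*\<^sup>* (Instr (synth acts locs \<phi> Map.empty) T) (Reached No)
            \<longrightarrow> T \<notin> sem \<phi> Map.empty Map.empty)
       \<and> (istep\<^sup>*\<^sup>* (Instr (synth acts locs \<phi> Map.empty) T) (Reached Yes)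
            \<longrightarrow> T \<in> sem \<phi> Map.empty Map.empty)"
proof -
  \<comment> \<open>Every \<open>n\<close> is covered, since \<open>acc_istep\<close> yields some
    bound without control over its size.\<close>
  have "sound n (synth acts locs \<phi> Map.empty) (sem \<phi> Map.empty Map.empty)" for n
    using sound_synth[of acts locs \<phi> Map.empty n Map.empty Map.empty] assms
    by (simp add: hyper_maxHML_def closed_formula_def closing_def psubst_empty)
  then show ?thesis
    unfolding sound_def using acc_istep by blast
qed

end
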